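(* Let $P$ be a minimal perimeter polyomino whose boundary contains the origin, let an orientation of the boundary of $P$ be chosen, and let $w$ be the word in the alphabet $\{a,b,a^{-1},b^{-1}\}$ read along the oriented boundary of $P$ starting from the origin. Then $w$ is a dead end word in $H(\mathbb{Z})$ with respect to $\{a,b\}$.
   Context: The discrete Heisenberg group is $H(\mathbb{Z}) = \left\{ \begin{pmatrix}1 & n & k \\ 0 & 1 & m\\ 0 & 0 & 1\end{pmatrix} : n,m,k \in \mathbb{Z}\right\}$, with presentation $\langle a,b \mid [[a,b],a]=1,\ [[a,b],b]=1\rangle$, where $a,b$ correspond to $\begin{pmatrix}1 & 1 & 0 \\ 0 & 1 & 0\\ 0 & 0 & 1\end{pmatrix}$ and $\begin{pmatrix}1 & 0 & 0 \\ 0 & 1 & 1\\ 0 & 0 & 1\end{pmatrix}$ respectively, and $[u,v]=uvu^{-1}v^{-1}$. Words are finite, not necessarily reduced, words in the alphabet $\{a,b,a^{-1},b^{-1}\}$; $|w|$ is the length of $w$ and $[w]\in H(\mathbb{Z})$ the element it represents. $l(g)$ is the least length of a word representing $g$; a word $w$ is geodesic if $l([w])=|w|$. A geodesic word $w$ is a dead end word if $ws$ is not geodesic for every $s\in\{a,b,a^{-1},b^{-1}\}$. A polyomino is a connected finite union of unit squares $[n,n+1]\times[m,m+1]\subset\mathbb{R}^2$, $n,m\in\mathbb{Z}$; its area, boundary and perimeter are defined in the natural way. A polyomino of area $k\in\mathbb{N}$, $k\geq 1$, is a minimal perimeter polyomino if it has the lowest possible perimeter among all polyominoes of area $k$. (It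 is known that this minimum is $2\lceil 2\sqrt{k}\,\rceil$ and that a minimal perimeter polyomino is contractible; its boundary is a simple closed polygonal chain of unit lattice edges.) The word read along the oriented boundary is obtained by traversing the boundary once, starting from the origin $(0,0)$ and following the orientation, writing $a,a^{-1},b,b^{-1}$ for a unit step by $(1,0),(-1,0),(0,1),(0,-1)$ respectively. *)

theory Defs
  imports "HOL-Analysis.Analysis" "HOL-Algebra.Group"
begin

section \<open>The discrete Heisenberg group and dead end words\<close>

definition heis_matrix :: "int \<Rightarrow> int \<Rightarrow> int \<Rightarrow> int ^ 3 ^ 3" where
  "heis_matrix n m k = vector [vector [1, n, k], vector [0, 1, m], vector [0, 0, 1]]"

definition heisenberg :: "(int ^ 3 ^ 3) monoid" where
  "heisenberg = \<lparr>carrier = {heis_matrix n m k | n m k. True}, mult = (**), one = mat 1\<rparr>"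

lemma heis_matrix_mult:
  "heis_matrix n m k ** heis_matrix n' m' k' = heis_matrix (n + n') (m + m') (k + k' + n * m')"
  by (simp add: heis_matrix_def matrix_matrix_mult_def vec_eq_iff forall_3 sum_3)

lemma heis_matrix_one: "heis_matrix 0 0 0 = mat 1"
  by (simp add: heis_matrix_def mat_def vec_eq_iff forall_3)

lemma group_heisenberg: "group heisenberg"
proof (rule groupI)
  fix x assume "x \<in> carrier heisenberg"
  then obtain n m k where x: "x = heis_matrix n m k"
    by (auto simp: heisenberg_def)
  have "heis_matrix (- n) (- m) (n * m - k) ** x = mat 1"
    by (simp add: x heis_matrix_mult flip: heis_matrix_one)
  then show "\<exists>y\<in>carrier heisenberg. y \<otimes>\<^bsub>heisenberg\<^esub> x = \<one>\<^bsub>heisenberg\<^esub>"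
    by (auto simp: heisenberg_def)
next
  show "\<one>\<^bsub>heisenberg\<^esub> \<in> carrier heisenberg"
    by (auto simp: heisenberg_def simp flip: heis_matrix_one)
next
  fix x y assume "x \<in> carrier heisenberg" "y \<in> carrier heisenberg"
  then show "x \<otimes>\<^bsub>heisenberg\<^esub> y \<in> carrier heisenberg"
    by (auto simp: heisenberg_def heis_matrix_mult) blast
qed (auto simp: heisenberg_def matrix_mul_assoc)

datatype letter = A | B | A_inv | B_inv

fun letter_elem :: "letter \<Rightarrow> int ^ 3 ^ 3" where
  "letter_elem A = heis_matrix 1 0 0"
| "letter_elem B = heis_matrix 0 1 0"
| "letter_elem A_inv = inv\<^bsub>heisenberg\<^esub> (heis_matrix 1 0 0)"
| "letter_elem B_inv = inv\<^bsub>heisenberg\<^esub> (heis_matrix 0 1 0)"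

definition word_elem :: "letter list \<Rightarrow> int ^ 3 ^ 3" where
  "word_elem w = foldr (\<lambda>s g. letter_elem s \<otimes>\<^bsub>heisenberg\<^esub> g) w \<one>\<^bsub>heisenberg\<^esub>"

definition word_length :: "int ^ 3 ^ 3 \<Rightarrow> nat" where
  "word_length g = (LEAST n. \<exists>w. word_elem w = g \<and> length w = n)"

definition geodesic_word :: "letter list \<Rightarrow> bool" where
  "geodesic_word w \<longleftrightarrow> word_length (word_elem w) = length w"

definition dead_end_word :: "letter list \<Rightarrow> bool" where
  "dead_end_word w \<longleftrightarrow> geodesic_word w \<and> (\<forall>s. \<not> geodesic_word (w @ [s]))"


section \<open>Lattice paths\<close>

fun step :: "letter \<Rightarrow> int \<times> int" where
  "step A = (1, 0)"
| "step B = (0, 1)"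
| "step A_inv = (-1, 0)"
| "step B_inv = (0, -1)"

definition lattice_point :: "int \<times> int \<Rightarrow> real \<times> real" where
  "lattice_point p = (real_of_int (fst p), real_of_int (snd p))"

definition unit_edge :: "int \<times> int \<Rightarrow> letter \<Rightarrow> (real \<times> real) set" where
  "unit_edge p s = closed_segment (lattice_point p) (lattice_point (p + step s))"

definition path_vertex :: "letter list \<Rightarrow> nat \<Rightarrow> int \<times> int" where
  "path_vertex w i = sum_list (map step (take i w))"


section \<open>Polyominoes\<close>

definition unit_square :: "int \<times> int \<Rightarrow> (real \<times> real) set" where
  "unit_square = (\<lambda>(n, m). {real_of_int n .. real_of_int n + 1} \<times> {real_of_int m .. real_of_int m + 1})"

definition polyomino :: "(real \<times> real) set \<Rightarrow> bool" where
  "polyomino P \<longleftrightarrow> connected P \<and> (\<exists>C. finite C \<and> P = (\<Union>c\<in>C. unit_square c))"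

definition area :: "(real \<times> real) set \<Rightarrow> real" where
  "area P = measure lebesgue P"

text \<open>The boundary of a polyomino \<open>P\<close> is its topological boundary \<^term>\<open>frontier P\<close>.  It is a union
  of unit lattice edges, namely of those that lie in exactly one unit square of \<open>P\<close>, so its length
  is the number of unit edges that it contains.  An edge is a set of points here, so the two
  descriptions of it as a \<^const>\<open>unit_edge\<close>, one for each direction, are counted once.\<close>

definition perimeter :: "(real \<times> real) set \<Rightarrow> nat" where
  "perimeter P = card {e. (\<exists>p s. e = unit_edge p s) \<and> e \<subseteq> frontier P}"

definition minimal_perimeter_polyomino :: "(real \<times> real) set \<Rightarrow> bool" where
  "minimal_perimeter_polyomino P \<longleftrightarrow> polyomino P \<and>
     (\<exists>k::nat. k \<ge> 1 \<and> area P = real k \<and>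
        (\<forall>Q. polyomino Q \<and> area Q = real k \<longrightarrow> perimeter P \<le> perimeter Q))"

text \<open>The lattice path from the origin with steps \<open>w\<close> is closed, does not meet itself
  before it closes up, and covers exactly the boundary of \<open>P\<close>.  If the boundary is a simple closed
  chain through the origin, exactly two words satisfy this, one for each orientation.\<close>

definition boundary_word :: "(real \<times> real) set \<Rightarrow> letter list \<Rightarrow> bool" where
  "boundary_word P w \<longleftrightarrow>
     path_vertex w (length w) = (0, 0) \<and>
     inj_on (path_vertex w) {..<length w} \<and>
     (\<Union>i<length w. unit_edge (path_vertex w i) (w ! i)) = frontier P"

end

(*
  A closed word represents the central element whose upper right entry is the integral of x dy along
  its path. A closed path with p letters A and q letters B has length 2 (p + q) and encloses at most
  the signed area p q, whereas any k <= p q cells can be arranged as a Young diagram in a p x q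
  rectangle, of perimeter at most 2 (p + q). Along the boundary word of P the polyomino stays on the
  same side, so by Green's identity its signed area is the area of P up to sign, and minimality of P
  makes the word geodesic. Since its element is central, the word may be shifted cyclically so as to
  end in the inverse of any given letter s; then s cancels.
*)

theory Submission
  imports Defs
begin

section \<open>Words in the Heisenberg group\<close>

fun opposite :: "letter \<Rightarrow> letter" where
  "opposite A = A_inv"
| "opposite B = B_inv"
| "opposite A_inv = A"
| "opposite B_inv = B"

lemma opposite_opposite [simp]: "opposite (opposite s) = s"
  by (cases s) auto

lemma step_opposite: "step (opposite s) = - step s"
  by (cases s) auto

lemma heis_matrix_eq_iff:
  "heis_matrix n m k = heis_matrix n' m' k' \<longleftrightarrow> n = n' \<and> m = m' \<and> k = k'"
  by (auto simp: heis_matrix_def vec_eq_iff forall_3)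

lemma inv_heis_matrix: "inv\<^bsub>heisenberg\<^esub> (heis_matrix n m k) = heis_matrix (- n) (- m) (n * m - k)"
proof -
  interpret group heisenberg by (rule group_heisenberg)
  show ?thesis
    by (rule inv_equality) (auto simp: heisenberg_def heis_matrix_mult simp flip: heis_matrix_one)
qed

lemma letter_elem_eq: "letter_elem s = heis_matrix (fst (step s)) (snd (step s)) 0"
  by (cases s) (auto simp: inv_heis_matrix)

lemma word_elem_Nil: "word_elem [] = heis_matrix 0 0 0"
  by (simp add: word_elem_def heisenberg_def heis_matrix_one)

lemma word_elem_append: "word_elem (u @ v) = word_elem u ** word_elem v"
proof (induction u)
  case Nil
  show ?case by (simp add: word_elem_Nil heis_matrix_one)
next
  case (Cons s u)
  then show ?case
    by (simp add: word_elem_def heisenberg_def matrix_mul_assoc)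
qed

lemma word_elem_single: "word_elem [s] = heis_matrix (fst (step s)) (snd (step s)) 0"
  by (simp add: word_elem_def heisenberg_def letter_elem_eq)

lemma word_length_le: "word_length (word_elem v) \<le> length v"
  unfolding word_length_def by (rule Least_le) auto

lemma geodesic_wordI:
  assumes "\<And>v. word_elem v = word_elem w \<Longrightarrow> length w \<le> length v"
  shows "geodesic_word w"
  unfolding geodesic_word_def word_length_def
  by (rule Least_equality) (use assms in auto)

section \<open>Vertices of a lattice path and the integral of \<open>x dy\<close>\<close>

lemma path_vertex_0 [simp]: "path_vertex w 0 = (0, 0)"
  by (simp add: path_vertex_def zero_prod_def)

lemma path_vertex_Suc: "i < length w \<Longrightarrow> path_vertex w (Suc i) = path_vertex w i + step (w ! i)"
  by (simp add: path_vertex_def take_Suc_conv_app_nth)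

lemma path_vertex_append: "i \<le> length u \<Longrightarrow> path_vertex (u @ v) i = path_vertex u i"
  by (simp add: path_vertex_def)

text \<open>The line integral of \<open>x dy\<close> along the path.\<close>

definition signed_area :: "letter list \<Rightarrow> int" where
  "signed_area w = (\<Sum>i<length w. fst (path_vertex w i) * snd (step (w ! i)))"

lemma signed_area_snoc:
  "signed_area (w @ [s]) = signed_area w + fst (path_vertex w (length w)) * snd (step s)"
proof -
  have "(\<Sum>i<length w. fst (path_vertex (w @ [s]) i) * snd (step ((w @ [s]) ! i))) = signed_area w"
    unfolding signed_area_def by (rule sum.cong) (auto simp: path_vertex_append nth_append)
  then show ?thesis by (simp add: signed_area_def path_vertex_append)
qed

text \<open>Multiplying by the matrix of a letter on the right adds the current abscissa times the
  vertical step to the upper right entry, which is the increment of the integral.\<close>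

lemma word_elem_eq:
  "word_elem w = heis_matrix (fst (path_vertex w (length w))) (snd (path_vertex w (length w)))
     (signed_area w)"
proof (induction w rule: rev_induct)
  case Nil
  show ?case by (simp add: word_elem_Nil signed_area_def)
next
  case (snoc s w)
  then show ?case
    by (simp add: word_elem_append word_elem_single heis_matrix_mult signed_area_snoc
        path_vertex_Suc path_vertex_append)
qed

section \<open>Letter counts and the area bound for closed paths\<close>

lemma sum_list_step:
  "sum_list (map step w) =
     (int (count_list w A) - int (count_list w A_inv), int (count_list w B) - int (count_list w B_inv))"
proof (induction w)
  case (Cons s w)
  then show ?case by (cases s) auto
qed (simp add: zero_prod_def)

lemma length_eq_count_letters:
  "length w = count_list w A + count_list w A_inv + count_list w B + count_list w B_inv"
proof (induction w)
  case (Cons s w)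
  then show ?case by (cases s) auto
qed simp

lemma count_list_take_mono: "i \<le> j \<Longrightarrow> count_list (take i w) s \<le> count_list (take j w) s"
  by (metis count_list_append le_add1 le_Suc_ex take_add)

lemma count_list_take_le: "count_list (take i w) s \<le> count_list w s"
  by (metis append_take_drop_id count_list_append le_add1)

lemma closed_path_counts:
  assumes "path_vertex w (length w) = (0, 0)"
  shows "count_list w A_inv = count_list w A" "count_list w B_inv = count_list w B"
    "length w = 2 * (count_list w A + count_list w B)"
  using assms length_eq_count_letters[of w] by (auto simp: path_vertex_def sum_list_step)

text \<open>If \<open>j \<le> i\<close>, the gain from \<open>j\<close> to \<open>i\<close> needs
  letters \<open>A\<close> in between; otherwise the loss from \<open>i\<close> to \<open>j\<close>
  needs letters \<open>A_inv\<close>, of which a closed path has equally many.\<close>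

lemma closed_path_width:
  assumes "path_vertex w (length w) = (0, 0)"
  shows "fst (path_vertex w i) - fst (path_vertex w j) \<le> int (count_list w A)"
proof -
  note le = count_list_take_le[of i w A] count_list_take_le[of j w A_inv]
  show ?thesis
  proof (cases "j \<le> i")
    case True
    then show ?thesis
      using le count_list_take_mono[OF True, of w A_inv]
      by (simp add: path_vertex_def sum_list_step)
  next
    case False
    then have "i \<le> j" by simp
    then show ?thesis
      using le count_list_take_mono[OF \<open>i \<le> j\<close>, of w A] closed_path_counts(1)[OF assms]
      by (simp add: path_vertex_def sum_list_step)
  qed
qed

lemma count_list_eq_card: "count_list w s = card {i. i < length w \<and> w ! i = s}"
  by (simp add: count_list_eq_length_filter length_filter_conv_card eq_commute)

lemma count_list_eq_sum: "int (count_list w s) = (\<Sum>i<length w. if w ! i = s then 1 else 0)"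
  by (simp add: count_list_eq_card sum.If_cases Collect_conj_eq lessThan_def Int_commute)

text \<open>Shifting the origin so that all abscissae lie in \<open>[0, p]\<close>, where \<open>p\<close> is the number of
  letters \<open>A\<close>, only the \<open>q\<close> letters \<open>B\<close> contribute positively to the integral of \<open>x dy\<close>, and only the
  \<open>q\<close> letters \<open>B_inv\<close> negatively.\<close>

lemma abs_signed_area_le:
  assumes "path_vertex w (length w) = (0, 0)"
  shows "\<bar>signed_area w\<bar> \<le> int (count_list w A * count_list w B)"
proof -
  define X where "X = (\<lambda>i. fst (path_vertex w i)) ` {..length w}"
  define m where "m = Min X"
  define p where "p = int (count_list w A)"
  have X: "finite X" "X \<noteq> {}" by (auto simp: X_def)
  have "m \<in> X" unfolding m_def using X by (rule Min_in)
  then obtain j where j: "m = fst (path_vertex w j)" by (auto simp: X_def)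
  have lower: "0 \<le> fst (path_vertex w i) - m" if "i < length w" for i
  proof -
    have "m \<le> fst (path_vertex w i)"
      unfolding m_def by (rule Min_le) (use X that in \<open>auto simp: X_def\<close>)
    then show ?thesis by simp
  qed
  have upper: "fst (path_vertex w i) - m \<le> p" for i
    using closed_path_width[OF assms] by (simp add: j p_def)
  have step: "snd (step s) = (if s = B then 1 else 0) - (if s = B_inv then 1 else 0)" for s
    by (cases s) auto
  \<comment> \<open>The vertical steps cancel, so subtracting \<open>m\<close> from every abscissa
    leaves the integral unchanged.\<close>
  have "(\<Sum>i<length w. snd (step (w ! i))) = 0"
    unfolding step sum_subtractf
    using closed_path_counts(2)[OF assms] by (simp flip: count_list_eq_sum)
  then have eq: "signed_area w = (\<Sum>i<length w. (fst (path_vertex w i) - m) * snd (step (w ! i)))"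
    by (simp add: signed_area_def left_diff_distrib sum_subtractf flip: sum_distrib_left)
  have "signed_area w \<le> (\<Sum>i<length w. p * (if w ! i = B then 1 else 0))"
    unfolding eq by (rule sum_mono) (use lower upper in \<open>auto simp: step\<close>)
  also have "\<dots> = p * int (count_list w B)"
    by (simp add: count_list_eq_sum flip: sum_distrib_left)
  finally have le: "signed_area w \<le> p * int (count_list w B)" .
  have "- signed_area w \<le> (\<Sum>i<length w. p * (if w ! i = B_inv then 1 else 0))"
    unfolding eq sum_negf[symmetric]
    by (rule sum_mono) (use lower upper in \<open>auto simp: step\<close>)
  also have "\<dots> = p * int (count_list w B)"
    by (simp flip: sum_distrib_left count_list_eq_sum add: closed_path_counts(2)[OF assms])
  finally show ?thesis using le by (simp add: p_def)
qed

text \<open>The area bound forces both \<open>A\<close> and \<open>B\<close> to occur, and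
  closedness then supplies their inverses.\<close>

lemma closed_path_letters:
  assumes "path_vertex w (length w) = (0, 0)" "signed_area w \<noteq> 0"
  shows "s \<in> set w"
proof -
  have "count_list w A * count_list w B \<noteq> 0"
    using abs_signed_area_le[OF assms(1)] assms(2) by (metis abs_le_zero_iff of_nat_0)
  then have "count_list w s \<noteq> 0"
    using closed_path_counts[OF assms(1)] by (cases s) auto
  then show ?thesis by (metis count_notin)
qed

text \<open>The element of a closed word is central, hence unchanged by cyclic shifts. Shifting \<open>w\<close> such
  that it ends in the inverse of \<open>s\<close> makes the letter \<open>s\<close> cancel.\<close>

lemma closed_word_not_geodesic_snoc:
  assumes closed: "path_vertex w (length w) = (0, 0)" and area: "signed_area w \<noteq> 0"
  shows "\<not> geodesic_word (w @ [s])"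
proof -
  obtain u v where w: "w = u @ opposite s # v"
    using closed_path_letters[OF assms] by (metis split_list)
  obtain n m k where u: "word_elem u = heis_matrix n m k" using word_elem_eq by blast
  obtain n' m' k' where v: "word_elem v = heis_matrix n' m' k'" using word_elem_eq by blast
  have "word_elem w = word_elem u ** (word_elem [opposite s] ** word_elem v)"
    by (simp add: w flip: word_elem_append)
  moreover have elem_w: "word_elem w = heis_matrix 0 0 (signed_area w)"
    using closed by (simp add: word_elem_eq)
  ultimately have "heis_matrix 0 0 (signed_area w) = heis_matrix (n - fst (step s) + n')
      (m - snd (step s) + m') (k + (k' - fst (step s) * m') + n * (m' - snd (step s)))"
    by (simp add: word_elem_single step_opposite u v heis_matrix_mult algebra_simps)
  then have n': "n' = fst (step s) - n" and m: "m = snd (step s) - m'"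
    and area_w: "signed_area w = k + (k' - fst (step s) * m') + n * (m' - snd (step s))"
    by (auto simp: heis_matrix_eq_iff)
  \<comment> \<open>This product is the only term in which the upper right entries of
    \<open>w @ [s]\<close> and \<open>v @ u\<close> could differ.\<close>
  have "fst (step s) * snd (step s) = 0" by (cases s) auto
  then have "signed_area w = k' + k + n' * m"
    unfolding n' m area_w by (simp add: algebra_simps)
  then have "word_elem (w @ [s]) = word_elem (v @ u)"
    unfolding word_elem_append elem_w word_elem_single u v heis_matrix_mult
    by (simp add: n' m)
  then have "word_length (word_elem (w @ [s])) \<le> length (v @ u)"
    using word_length_le by metis
  then show ?thesis by (simp add: geodesic_word_def w)
qed

section \<open>Edges and cells of the square lattice\<close>

text \<open>An edge is given by its lower or left end point, a cell by its lower left corner. The left and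
  right cells of an edge refer to its traversal in the positive direction.\<close>

datatype edge = Horiz "int \<times> int" | Vert "int \<times> int"

fun lattice_edge :: "int \<times> int \<Rightarrow> letter \<Rightarrow> edge" where
  "lattice_edge (x, y) A = Horiz (x, y)"
| "lattice_edge (x, y) B = Vert (x, y)"
| "lattice_edge (x, y) A_inv = Horiz (x - 1, y)"
| "lattice_edge (x, y) B_inv = Vert (x, y - 1)"

fun edge_set :: "edge \<Rightarrow> (real \<times> real) set" where
  "edge_set (Horiz (x, y)) = {real_of_int x .. real_of_int x + 1} \<times> {real_of_int y}"
| "edge_set (Vert (x, y)) = {real_of_int x} \<times> {real_of_int y .. real_of_int y + 1}"

fun edge_mid :: "edge \<Rightarrow> real \<times> real" where
  "edge_mid (Horiz (x, y)) = (real_of_int x + 1/2, real_of_int y)"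
| "edge_mid (Vert (x, y)) = (real_of_int x, real_of_int y + 1/2)"

fun left_cell :: "edge \<Rightarrow> int \<times> int" where
  "left_cell (Horiz (x, y)) = (x, y)"
| "left_cell (Vert (x, y)) = (x - 1, y)"

fun right_cell :: "edge \<Rightarrow> int \<times> int" where
  "right_cell (Horiz (x, y)) = (x, y - 1)"
| "right_cell (Vert (x, y)) = (x, y)"

definition boundary_edges :: "(int \<times> int) set \<Rightarrow> edge set" where
  "boundary_edges C = {e. (left_cell e \<in> C) \<noteq> (right_cell e \<in> C)}"

lemma closed_segment_horizontal:
  "closed_segment (a, c) (b, c :: real) = closed_segment a b \<times> {c}"
  by (auto simp: closed_segment_def simp del: real_scaleR_def)

lemma closed_segment_vertical:
  "closed_segment (c :: real, a) (c, b) = {c} \<times> closed_segment a b"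
  by (auto simp: closed_segment_def simp del: real_scaleR_def)

lemma unit_edge_eq: "unit_edge p s = edge_set (lattice_edge p s)"
  by (cases p; cases s)
    (auto simp: unit_edge_def lattice_point_def closed_segment_horizontal closed_segment_vertical
      closed_segment_eq_real_ivl)

text \<open>Doubling both sides reduces these to parity and order of integers.\<close>

lemma half_between_integers:
  "real_of_int x + 1/2 \<noteq> real_of_int y"
  "real_of_int y \<noteq> real_of_int x + 1/2"
  "real_of_int x \<le> real_of_int y + 1/2 \<longleftrightarrow> x \<le> y"
  "real_of_int y + 1/2 \<le> real_of_int x + 1 \<longleftrightarrow> y \<le> x"
proof -
  have "real_of_int (2 * x + 1) \<noteq> real_of_int (2 * y)"
    unfolding of_int_eq_iff by presburger
  then show "real_of_int x + 1/2 \<noteq> real_of_int y" "real_of_int y \<noteq> real_of_int x + 1/2"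
    unfolding of_int_add of_int_mult by linarith+
  have "2 * x \<le> 2 * y + 1 \<longleftrightarrow> x \<le> y" by presburger
  then have "real_of_int (2 * x) \<le> real_of_int (2 * y + 1) \<longleftrightarrow> x \<le> y" by (simp only: of_int_le_iff)
  then show "real_of_int x \<le> real_of_int y + 1/2 \<longleftrightarrow> x \<le> y" by auto
  have "2 * y + 1 \<le> 2 * x + 2 \<longleftrightarrow> y \<le> x" by presburger
  then have "real_of_int (2 * y + 1) \<le> real_of_int (2 * x + 2) \<longleftrightarrow> y \<le> x"
    by (simp only: of_int_le_iff)
  then show "real_of_int y + 1/2 \<le> real_of_int x + 1 \<longleftrightarrow> y \<le> x" by auto
qed

text \<open>Midpoints represent edges by points, which turns equations between subsets of the plane
  into statements about single edges.\<close>

lemma edge_mid_in_edge_set_iff: "edge_mid e \<in> edge_set e' \<longleftrightarrow> e = e'"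
  by (cases e rule: edge_mid.cases; cases e' rule: edge_mid.cases)
    (auto simp: half_between_integers)

lemma lattice_edge_eq_iff:
  "lattice_edge p s = lattice_edge q t \<longleftrightarrow> p = q \<and> s = t \<or> q = p + step s \<and> t = opposite s"
  by (cases p; cases q; cases s; cases t) auto

lemma lattice_edge_opposite: "lattice_edge (p + step s) (opposite s) = lattice_edge p s"
  by (cases p; cases s) auto

lemma finite_boundary_edges:
  assumes "finite C"
  shows "finite (boundary_edges C)"
proof (rule finite_subset)
  show "boundary_edges C \<subseteq> Horiz ` C \<union> (\<lambda>(x, y). Horiz (x, y + 1)) ` C \<union>
      Vert ` C \<union> (\<lambda>(x, y). Vert (x + 1, y)) ` C"
  proof
    fix e assume "e \<in> boundary_edges C"
    then show "e \<in> Horiz ` C \<union> (\<lambda>(x, y). Horiz (x, y + 1)) ` C \<union>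
      Vert ` C \<union> (\<lambda>(x, y). Vert (x + 1, y)) ` C"
      by (cases e rule: edge_mid.cases) (force simp: boundary_edges_def)+
  qed
qed (use assms in auto)

lemma mem_unit_square_iff:
  "(a, b) \<in> unit_square (x, y) \<longleftrightarrow>
     real_of_int x \<le> a \<and> a \<le> real_of_int x + 1 \<and> real_of_int y \<le> b \<and> b \<le> real_of_int y + 1"
  by (auto simp: unit_square_def)

lemma unit_square_eq_cbox:
  "unit_square (x, y) = cbox (real_of_int x, real_of_int y) (real_of_int x + 1, real_of_int y + 1)"
  by (simp add: unit_square_def cbox_Pair_eq)

section \<open>The frontier of a union of cells\<close>

text \<open>Near \<open>m\<close> the flags \<open>a\<close> and \<open>b\<close> select two
  opposite closed half planes making up \<open>P\<close>. With both or neither, \<open>m\<close> is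
  interior to \<open>P\<close> or to its complement; with exactly one, \<open>m\<close> is in
  \<open>P\<close> but points of the complement approach it.\<close>

lemma frontier_half_planes:
  fixes m d :: "'a::real_normed_vector" and f :: "'a \<Rightarrow> real"
  assumes "open U" "m \<in> U"
    and near: "\<And>z. z \<in> U \<Longrightarrow> z \<in> P \<longleftrightarrow> a \<and> f m \<le> f z \<or> b \<and> f z \<le> f m"
    and f: "\<And>t. f (m + t *\<^sub>R d) = f m + t"
  shows "m \<in> frontier P \<longleftrightarrow> a \<noteq> b"
proof (cases "a = b")
  case True
  have "m \<in> interior P \<or> m \<in> interior (- P)"
  proof (cases a)
    case a: True
    then have "U \<subseteq> P" using near True by force
    then show ?thesis using interiorI[OF assms(1,2)] by blast
  next
    case False
    then have "U \<subseteq> - P" using near True by force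
    then show ?thesis using interiorI[OF assms(1,2)] by blast
  qed
  then show ?thesis using True by (auto simp: frontier_def interior_complement)
next
  case False
  \<comment> \<open>The sequence tends to \<open>m\<close> along \<open>d\<close> from the side that
    \<open>P\<close> lacks.\<close>
  define g where "g = (\<lambda>n. m + ((if a then - 1 else 1) * inverse (real (Suc n))) *\<^sub>R d)"
  have "g \<longlonglongrightarrow> m + ((if a then - 1 else 1) * 0) *\<^sub>R d"
    unfolding g_def by (intro tendsto_intros LIMSEQ_inverse_real_of_nat)
  then have lim: "g \<longlonglongrightarrow> m" by simp
  then have "eventually (\<lambda>n. g n \<in> U) sequentially"
    using assms(1,2) by (rule topological_tendstoD)
  then have "eventually (\<lambda>n. g n \<in> closure (- P)) sequentially"
  proof (eventually_elim)
    case (elim n)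
    have "f (g n) = f m + (if a then - 1 else 1) * inverse (real (Suc n))"
      unfolding g_def by (rule f)
    moreover have "inverse (real (Suc n)) > 0" by simp
    ultimately have "g n \<in> - P" using near[OF elim] False by (auto split: if_splits)
    then show ?case using closure_subset by blast
  qed
  then have "m \<in> closure (- P)"
    by (rule Lim_in_closed_set[OF closed_closure _ sequentially_bot lim])
  moreover have "m \<in> P" using near[OF assms(2)] False by auto
  ultimately have "m \<in> closure P \<inter> closure (- P)" using closure_subset by blast
  then show ?thesis using False by (simp add: frontier_closures)
qed

text \<open>The open box \<open>U\<close> around the midpoint meets no cells except the two adjacent
  to \<open>e\<close>, so the half plane criterion applies.\<close>

lemma edge_mid_in_frontier_iff:
  "edge_mid e \<in> frontier (\<Union>c\<in>C. unit_square c) \<longleftrightarrow> e \<in> boundary_edges C"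
proof (cases e rule: edge_mid.cases)
  case (1 x y)
  define U where "U = {real_of_int x<..<real_of_int x + 1} \<times> {real_of_int y - 1<..<real_of_int y + 1}"
  have U: "(a, b) \<in> unit_square (n, m) \<longleftrightarrow>
      n = x \<and> (m = y \<and> real_of_int y \<le> b \<or> m = y - 1 \<and> b \<le> real_of_int y)" if "(a, b) \<in> U" for a b n m
    unfolding mem_unit_square_iff
  proof
    assume *: "real_of_int n \<le> a \<and> a \<le> real_of_int n + 1 \<and> real_of_int m \<le> b \<and> b \<le> real_of_int m + 1"
    then have "n < x + 1" "x < n + 1" "m < y + 1" "y - 1 < m + 1"
      using that by (auto simp: U_def)
    then have "n = x" "m = y \<or> m = y - 1" by auto
    then show "n = x \<and> (m = y \<and> real_of_int y \<le> b \<or> m = y - 1 \<and> b \<le> real_of_int y)"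
      using * by auto
  qed (use that in \<open>auto simp: U_def\<close>)
  have "edge_mid e \<in> frontier (\<Union>c\<in>C. unit_square c) \<longleftrightarrow> ((x, y) \<in> C) \<noteq> ((x, y - 1) \<in> C)"
  proof (rule frontier_half_planes[where U = U and d = "(0, 1)" and f = snd])
    show "z \<in> (\<Union>c\<in>C. unit_square c) \<longleftrightarrow>
        (x, y) \<in> C \<and> snd (edge_mid e) \<le> snd z \<or> (x, y - 1) \<in> C \<and> snd z \<le> snd (edge_mid e)"
      if "z \<in> U" for z
    proof -
      obtain a b where z: "z = (a, b)" by (cases z)
      have "z \<in> (\<Union>c\<in>C. unit_square c) \<longleftrightarrow> (\<exists>n m. (n, m) \<in> C \<and> (a, b) \<in> unit_square (n, m))"
        unfolding z by force
      also have "\<dots> \<longleftrightarrow> (\<exists>n m. (n, m) \<in> C \<and> n = x \<and> (m = y \<and> real_of_int y \<le> b \<or> m = y - 1 \<and> b \<le> real_of_int y))"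
        using U that z by simp
      finally show ?thesis by (auto simp: z 1)
    qed
  qed (auto simp: U_def 1 open_Times)
  then show ?thesis by (simp add: boundary_edges_def 1)
next
  case (2 x y)
  define U where "U = {real_of_int x - 1<..<real_of_int x + 1} \<times> {real_of_int y<..<real_of_int y + 1}"
  have U: "(a, b) \<in> unit_square (n, m) \<longleftrightarrow>
      m = y \<and> (n = x \<and> real_of_int x \<le> a \<or> n = x - 1 \<and> a \<le> real_of_int x)" if "(a, b) \<in> U" for a b n m
    unfolding mem_unit_square_iff
  proof
    assume *: "real_of_int n \<le> a \<and> a \<le> real_of_int n + 1 \<and> real_of_int m \<le> b \<and> b \<le> real_of_int m + 1"
    then have "m < y + 1" "y < m + 1" "n < x + 1" "x - 1 < n + 1"
      using that by (auto simp: U_def)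
    then have "m = y" "n = x \<or> n = x - 1" by auto
    then show "m = y \<and> (n = x \<and> real_of_int x \<le> a \<or> n = x - 1 \<and> a \<le> real_of_int x)"
      using * by auto
  qed (use that in \<open>auto simp: U_def\<close>)
  have "edge_mid e \<in> frontier (\<Union>c\<in>C. unit_square c) \<longleftrightarrow> ((x, y) \<in> C) \<noteq> ((x - 1, y) \<in> C)"
  proof (rule frontier_half_planes[where U = U and d = "(1, 0)" and f = fst])
    show "z \<in> (\<Union>c\<in>C. unit_square c) \<longleftrightarrow>
        (x, y) \<in> C \<and> fst (edge_mid e) \<le> fst z \<or> (x - 1, y) \<in> C \<and> fst z \<le> fst (edge_mid e)"
      if "z \<in> U" for z
    proof -
      obtain a b where z: "z = (a, b)" by (cases z)
      have "z \<in> (\<Union>c\<in>C. unit_square c) \<longleftrightarrow> (\<exists>n m. (n, m) \<in> C \<and> (a, b) \<in> unit_square (n, m))"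
        unfolding z by force
      also have "\<dots> \<longleftrightarrow> (\<exists>n m. (n, m) \<in> C \<and> m = y \<and> (n = x \<and> real_of_int x \<le> a \<or> n = x - 1 \<and> a \<le> real_of_int x))"
        using U that z by simp
      finally show ?thesis by (auto simp: z 2)
    qed
  qed (auto simp: U_def 2 open_Times)
  then show ?thesis by (auto simp add: boundary_edges_def 2)
qed

lemma unit_edges_in_frontier:
   "{e. (\<exists>p s. e = unit_edge p s) \<and> e \<subseteq> frontier (\<Union>c\<in>C. unit_square c)}
    \<subseteq> edge_set ` boundary_edges C"
proof clarify
  fix p s assume "unit_edge p s \<subseteq> frontier (\<Union>c\<in>C. unit_square c)"
  moreover have "edge_mid (lattice_edge p s) \<in> unit_edge p s"
    by (simp add: unit_edge_eq edge_mid_in_edge_set_iff)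
  ultimately have "lattice_edge p s \<in> boundary_edges C"
    using edge_mid_in_frontier_iff by blast
  then show "unit_edge p s \<in> edge_set ` boundary_edges C"
    by (simp add: unit_edge_eq)
qed

text \<open>Since \<open>card\<close> is 0 on infinite sets, lower bounds on
  \<open>perimeter\<close> rest on this finiteness.\<close>

lemma finite_unit_edges_in_frontier:
  assumes "finite C"
  shows "finite {e. (\<exists>p s. e = unit_edge p s) \<and> e \<subseteq> frontier (\<Union>c\<in>C. unit_square c)}"
  using unit_edges_in_frontier finite_boundary_edges[OF assms]
  by (meson finite_imageI finite_subset)

lemma perimeter_le_card_boundary_edges:
  assumes "finite C"
  shows "perimeter (\<Union>c\<in>C. unit_square c) \<le> card (boundary_edges C)"
proof -
  have "perimeter (\<Union>c\<in>C. unit_square c) \<le> card (edge_set ` boundary_edges C)"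
    unfolding perimeter_def
    by (rule card_mono[OF _ unit_edges_in_frontier])
      (simp add: finite_boundary_edges assms)
  also have "\<dots> \<le> card (boundary_edges C)"
    by (rule card_image_le) (simp add: finite_boundary_edges assms)
  finally show ?thesis .
qed

section \<open>Area of a union of cells\<close>

lemma area_Union_unit_squares:
  assumes "finite C"
  shows "area (\<Union>c\<in>C. unit_square c) = real (card C)"
proof -
  have "negligible (unit_square c \<inter> unit_square d)" if "c \<noteq> d" for c d
  proof -
    obtain x y x' y' where cd: "c = (x, y)" "d = (x', y')" by (cases c; cases d)
    \<comment> \<open>This box contains the intersection and has a side of length at most 0 in each
      coordinate in which the cells differ.\<close>
    define I where "I = cbox (real_of_int (max x x'), real_of_int (max y y'))
      (real_of_int (min x x') + 1, real_of_int (min y y') + 1)"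
    have "measure lborel I = 0"
      unfolding I_def content_Pair using that cd by (auto simp: content_real_eq_0)
    then have "negligible I"
      unfolding I_def by (simp add: negligible_interval content_eq_0_interior)
    moreover have "unit_square c \<inter> unit_square d \<subseteq> I"
      by (auto simp: I_def cd unit_square_eq_cbox)
    ultimately show ?thesis by (rule negligible_subset)
  qed
  then have "area (\<Union>c\<in>C. unit_square c) = (\<Sum>c\<in>C. measure lebesgue (unit_square c))"
    unfolding area_def
    by (intro measure_negligible_finite_Union_image assms)
      (auto simp: pairwise_def unit_square_eq_cbox)
  also have "\<dots> = (\<Sum>c\<in>C. 1)"
    by (rule sum.cong) (auto simp: unit_square_eq_cbox content_Pair)
  finally show ?thesis by simp
qed

section \<open>Young diagrams\<close>

text \<open>Every row and every column of a Young diagram contributes at most two boundary edges.\<close>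

lemma card_boundary_edges_Young_diagram:
  fixes p q :: nat
  assumes box: "C \<subseteq> {0..<int p} \<times> {0..<int q}"
    and down: "\<And>x y x' y'. (x, y) \<in> C \<Longrightarrow> 0 \<le> x' \<Longrightarrow> x' \<le> x \<Longrightarrow> 0 \<le> y' \<Longrightarrow> y' \<le> y \<Longrightarrow> (x', y') \<in> C"
  shows "card (boundary_edges C) \<le> 2 * (p + q)"
proof -
  \<comment> \<open>An edge is sent to its column or row together with a flag for lying on the axis;
    each column or row has at most one edge off the axis, at its end.\<close>
  define f where "f e = (case e of Horiz (x, y) \<Rightarrow> (True, x, y = 0) | Vert (x, y) \<Rightarrow> (False, y, x = 0))" for e
  let ?T = "{True} \<times> {0..<int p} \<times> (UNIV :: bool set) \<union> {False} \<times> {0..<int q} \<times> (UNIV :: bool set)"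
  have H: "0 \<le> x \<and> x < int p \<and> (y \<noteq> 0 \<longrightarrow> 0 < y \<and> (x, y - 1) \<in> C \<and> (x, y) \<notin> C)"
    if "Horiz (x, y) \<in> boundary_edges C" for x y
  proof -
    have *: "((x, y) \<in> C) \<noteq> ((x, y - 1) \<in> C)" using that by (simp add: boundary_edges_def)
    then have x: "0 \<le> x \<and> x < int p" and y: "0 \<le> y" using box by fastforce+
    have "(x, y) \<in> C \<Longrightarrow> y \<noteq> 0 \<Longrightarrow> (x, y - 1) \<in> C" using down[of x y x "y - 1"] x y by auto
    then show ?thesis using * x y by auto
  qed
  have V: "0 \<le> y \<and> y < int q \<and> (x \<noteq> 0 \<longrightarrow> 0 < x \<and> (x - 1, y) \<in> C \<and> (x, y) \<notin> C)"
    if "Vert (x, y) \<in> boundary_edges C" for x y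
  proof -
    have *: "((x - 1, y) \<in> C) \<noteq> ((x, y) \<in> C)" using that by (simp add: boundary_edges_def)
    then have y: "0 \<le> y \<and> y < int q" and x: "0 \<le> x" using box by fastforce+
    have "(x, y) \<in> C \<Longrightarrow> x \<noteq> 0 \<Longrightarrow> (x - 1, y) \<in> C" using down[of x y "x - 1" y] x y by auto
    then show ?thesis using * x y by auto
  qed
  \<comment> \<open>If \<open>y < y'\<close>, the cell \<open>(x, y' - 1)\<close> of
    \<open>C\<close> would put \<open>(x, y)\<close> into \<open>C\<close> by \<open>down\<close>,
    contradicting \<open>H\<close>.\<close>
  have H_unique: "\<not> y < y'"
    if "Horiz (x, y) \<in> boundary_edges C" "Horiz (x, y') \<in> boundary_edges C" "y \<noteq> 0" "y' \<noteq> 0" for x y y'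
    using H[OF that(1)] H[OF that(2)] that(3,4) down[of x "y' - 1" x y] by auto
  have V_unique: "\<not> x < x'"
    if "Vert (x, y) \<in> boundary_edges C" "Vert (x', y) \<in> boundary_edges C" "x \<noteq> 0" "x' \<noteq> 0" for x x' y
    using V[OF that(1)] V[OF that(2)] that(3,4) down[of "x' - 1" y x y] by auto
  have inj: "inj_on f (boundary_edges C)"
  proof (rule inj_onI)
    fix e e' assume e: "e \<in> boundary_edges C" "e' \<in> boundary_edges C" and eq: "f e = f e'"
    show "e = e'"
    proof (cases e rule: edge_mid.cases)
      case (1 x y)
      then obtain y' where e': "e' = Horiz (x, y')" "y = 0 \<longleftrightarrow> y' = 0"
        using eq by (cases e' rule: edge_mid.cases) (auto simp: f_def)
      then show ?thesis using e H_unique[of x y y'] H_unique[of x y' y] 1 by force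
    next
      case (2 x y)
      then obtain x' where e': "e' = Vert (x', y)" "x = 0 \<longleftrightarrow> x' = 0"
        using eq by (cases e' rule: edge_mid.cases) (auto simp: f_def)
      then show ?thesis using e V_unique[of x y x'] V_unique[of x' y x] 2 by force
    qed
  qed
  have "f e \<in> ?T" if "e \<in> boundary_edges C" for e
    using that H V by (cases e rule: edge_mid.cases) (auto simp: f_def)
  then have "f ` boundary_edges C \<subseteq> ?T" by blast
  then have "card (boundary_edges C) \<le> card ?T"
    by (rule card_inj_on_le[OF inj]) auto
  also have "\<dots> = 2 * (p + q)"
    by (subst card_Un_disjoint) (auto simp: card_cartesian_product)
  finally show ?thesis .
qed

text \<open>The competitor for \<open>P\<close>: the first \<open>k\<close> cells of the rectangle,
  filled column by column from the left, form a Young diagram.\<close>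

lemma polyomino_in_rectangle:
  fixes k p q :: nat
  assumes "1 \<le> k" "k \<le> p * q"
  shows "\<exists>Q. polyomino Q \<and> area Q = real k \<and> perimeter Q \<le> 2 * (p + q)"
proof -
  define c where "c n = (int (n div q), int (n mod q))" for n
  define Q where "Q = (\<Union>c\<in>c ` {..<k}. unit_square c)"
  have q: "q > 0" using assms by (cases q) auto
  have "inj c"
  proof (rule injI)
    fix m n assume "c m = c n"
    then show "m = n" by (metis c_def div_mult_mod_eq of_nat_eq_iff prod.inject)
  qed
  then have card: "card (c ` {..<k}) = k"
    by (metis card_image card_lessThan inj_on_subset subset_UNIV)
  have mem: "(int i, int j) \<in> c ` {..<k} \<longleftrightarrow> i * q + j < k \<and> j < q" for i j
  proof
    assume "i * q + j < k \<and> j < q"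
    then show "(int i, int j) \<in> c ` {..<k}"
      by (intro image_eqI[of _ _ "i * q + j"]) (auto simp: c_def)
  qed (use q in \<open>auto simp: c_def\<close>)
  have "connected (\<Union>n<m. unit_square (c n))" for m
  proof (induction m)
    case (Suc m)
    show ?case
    proof (cases "m = 0")
      case True
      then show ?thesis
        by (simp add: c_def lessThan_Suc unit_square_eq_cbox convex_connected)
    next
      case False
      \<comment> \<open>A new cell touches the one below it or, at the bottom of a column, the
        bottom cell of the previous column.\<close>
      have "\<exists>n<m. unit_square (c n) \<inter> unit_square (c m) \<noteq> {}"
      proof (cases "m mod q = 0")
        case True
        then obtain i where m: "m = i * q" by (metis dvd_div_mult_self mod_0_imp_dvd)
        with False obtain i' where i: "i = Suc i'" by (cases i) auto
        have "(real i, 0) \<in> unit_square (c (i' * q)) \<inter> unit_square (c m)"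
          using q by (simp add: c_def mem_unit_square_iff m i)
        moreover have "i' * q < m" using q by (simp add: m i)
        ultimately show ?thesis by blast
      next
        case nz: False
        then obtain j where j: "m mod q = Suc j" by (cases "m mod q") auto
        define i where "i = m div q"
        have m: "m = i * q + Suc j" by (metis div_mult_mod_eq i_def j)
        have "Suc j < q" using q by (metis j mod_less_divisor)
        then have "(real i, real (Suc j)) \<in> unit_square (c (i * q + j)) \<inter> unit_square (c m)"
          using q by (simp add: c_def mem_unit_square_iff m del: add_Suc_right)
        moreover have "i * q + j < m" by (simp add: m)
        ultimately show ?thesis by blast
      qed
      then have "unit_square (c m) \<inter> (\<Union>n<m. unit_square (c n)) \<noteq> {}" by blast
      moreover have "connected (unit_square (c m))"
        by (simp add: c_def unit_square_eq_cbox convex_connected)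
      ultimately show ?thesis
        using Suc by (simp add: lessThan_Suc connected_Un)
    qed
  qed simp
  then have "connected Q" by (simp add: Q_def)
  then have "polyomino Q" unfolding polyomino_def Q_def by blast
  moreover have "area Q = real k"
    unfolding Q_def by (subst area_Union_unit_squares) (simp_all only: card finite_imageI finite_lessThan)
  moreover have "card (boundary_edges (c ` {..<k})) \<le> 2 * (p + q)"
  proof (rule card_boundary_edges_Young_diagram)
    have "n div q < p" if "n < k" for n
      using that assms(2) by (simp add: less_mult_imp_div_less)
    then show "c ` {..<k} \<subseteq> {0..<int p} \<times> {0..<int q}"
      using q by (auto simp: c_def)
    fix x y x' y' :: int
    assume "(x, y) \<in> c ` {..<k}" and le: "0 \<le> x'" "x' \<le> x" "0 \<le> y'" "y' \<le> y"
    then have "nat x * q + nat y < k \<and> nat y < q" using mem[of "nat x" "nat y"] by simp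
    moreover have "nat x' * q + nat y' \<le> nat x * q + nat y"
      using le by (intro add_mono mult_right_mono) auto
    ultimately have "nat x' * q + nat y' < k \<and> nat y' < q" using le by linarith
    then show "(x', y') \<in> c ` {..<k}" using mem[of "nat x'" "nat y'"] le by simp
  qed
  then have "perimeter Q \<le> 2 * (p + q)"
    unfolding Q_def using perimeter_le_card_boundary_edges[of "c ` {..<k}"] by simp
  ultimately show ?thesis by blast
qed

section \<open>Boundary words\<close>

text \<open>Unlike \<open>left_cell\<close>, this respects the direction in which the step is
  taken.\<close>

fun cell_left :: "int \<times> int \<Rightarrow> letter \<Rightarrow> int \<times> int" where
  "cell_left (x, y) A = (x, y)"
| "cell_left (x, y) B = (x - 1, y)"
| "cell_left (x, y) A_inv = (x - 1, y - 1)"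
| "cell_left (x, y) B_inv = (x, y - 1)"

text \<open>Testing the covering of the frontier at midpoints recovers the set of traversed
  edges.\<close>

lemma boundary_word_edges:
  assumes "boundary_word (\<Union>c\<in>C. unit_square c) w"
  shows "e \<in> boundary_edges C \<longleftrightarrow> (\<exists>i<length w. e = lattice_edge (path_vertex w i) (w ! i))"
proof -
  have "(\<Union>i<length w. edge_set (lattice_edge (path_vertex w i) (w ! i)))
      = frontier (\<Union>c\<in>C. unit_square c)"
    using assms by (simp add: boundary_word_def unit_edge_eq)
  then have "e \<in> boundary_edges C \<longleftrightarrow>
      edge_mid e \<in> (\<Union>i<length w. edge_set (lattice_edge (path_vertex w i) (w ! i)))"
    by (simp add: edge_mid_in_frontier_iff)
  then show ?thesis by (auto simp: edge_mid_in_edge_set_iff)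
qed

text \<open>The path visits this vertex only once, so it uses only the arriving and the departing
  edge there.\<close>

lemma boundary_word_edges_at_vertex:
  assumes bw: "boundary_word (\<Union>c\<in>C. unit_square c) w" and i: "Suc i < length w"
  shows "lattice_edge (path_vertex w (Suc i)) s \<in> boundary_edges C \<longleftrightarrow>
    s = w ! Suc i \<or> s = opposite (w ! i)"
proof
  have inj: "inj_on (path_vertex w) {..<length w}" and closed: "path_vertex w (length w) = (0, 0)"
    using bw by (auto simp: boundary_word_def)
  assume "lattice_edge (path_vertex w (Suc i)) s \<in> boundary_edges C"
  then obtain t where t: "t < length w"
    and eq: "lattice_edge (path_vertex w (Suc i)) s = lattice_edge (path_vertex w t) (w ! t)"
    using boundary_word_edges[OF bw] by blast
  from eq consider "path_vertex w (Suc i) = path_vertex w t" "s = w ! t"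
    | "path_vertex w t = path_vertex w (Suc i) + step s" "w ! t = opposite s"
    unfolding lattice_edge_eq_iff by blast
  then show "s = w ! Suc i \<or> s = opposite (w ! i)"
  proof cases
    case 1
    then show ?thesis using inj_onD[OF inj, of "Suc i" t] t i by simp
  next
    case 2
    then have v: "path_vertex w (Suc t) = path_vertex w (Suc i)"
      using t by (simp add: path_vertex_Suc step_opposite)
    \<comment> \<open>The last step returns to vertex 0, which differs from vertex
      \<open>Suc i\<close>.\<close>
    have "Suc t \<noteq> length w"
    proof
      assume "Suc t = length w"
      then have "path_vertex w (Suc i) = path_vertex w 0" using v closed by simp
      then have "Suc i = 0" by (rule inj_onD[OF inj]) (use i in auto)
      then show False by simp
    qed
    then have "Suc t = Suc i" using t i v by (intro inj_onD[OF inj v]) auto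
    then show ?thesis using 2 by simp
  qed
next
  assume "s = w ! Suc i \<or> s = opposite (w ! i)"
  then show "lattice_edge (path_vertex w (Suc i)) s \<in> boundary_edges C"
  proof
    assume "s = w ! Suc i"
    then show ?thesis using boundary_word_edges[OF bw] i by blast
  next
    assume "s = opposite (w ! i)"
    then have "lattice_edge (path_vertex w (Suc i)) s = lattice_edge (path_vertex w i) (w ! i)"
      using i by (simp add: path_vertex_Suc lattice_edge_opposite)
    then show ?thesis using boundary_word_edges[OF bw] i by (metis Suc_lessD)
  qed
qed

text \<open>Going around a vertex, membership in \<open>C\<close> changes exactly at the boundary edges. Hence their
  number is even, and if there are only an incoming and an outgoing one, then the cells to the left
  of the path are on the same side.\<close>

lemma cell_left_around_vertex:
  assumes "\<And>s. lattice_edge v s \<in> boundary_edges C \<longleftrightarrow> s = t \<or> s = opposite r"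
  shows "t \<noteq> opposite r" "cell_left (v - step r) r \<in> C \<longleftrightarrow> cell_left v t \<in> C"
proof -
  obtain x y where v: "v = (x, y)" by (cases v)
  note * = assms[of A] assms[of B] assms[of A_inv] assms[of B_inv]
  show "t \<noteq> opposite r"
    using * by (cases t; cases r) (auto simp: v boundary_edges_def)
  show "cell_left (v - step r) r \<in> C \<longleftrightarrow> cell_left v t \<in> C"
    using * by (cases t; cases r) (auto simp: v boundary_edges_def)
qed

text \<open>The side is carried from each step to the next across their common vertex.\<close>

lemma boundary_word_cell_left:
  assumes bw: "boundary_word (\<Union>c\<in>C. unit_square c) w" and "i < length w"
  shows "cell_left (path_vertex w i) (w ! i) \<in> C \<longleftrightarrow> cell_left (0, 0) (w ! 0) \<in> C"
  using assms(2)
proof (induction i)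
  case (Suc i)
  then show ?case
    using cell_left_around_vertex(2)[OF boundary_word_edges_at_vertex[OF bw]]
    by (simp add: path_vertex_Suc)
qed simp

text \<open>Steps start at distinct vertices, so a repeated edge is run through in opposite
  directions. Simplicity of the path then makes the two steps consecutive, and an immediate reversal
  is excluded at the vertex between them.\<close>

lemma boundary_word_inj_edges:
  assumes bw: "boundary_word (\<Union>c\<in>C. unit_square c) w"
  shows "inj_on (\<lambda>i. lattice_edge (path_vertex w i) (w ! i)) {..<length w}"
proof (rule inj_onI, rule ccontr)
  have inj: "inj_on (path_vertex w) {..<length w}" and closed: "path_vertex w (length w) = (0, 0)"
    using bw by (auto simp: boundary_word_def)
  fix i j assume "i \<in> {..<length w}" "j \<in> {..<length w}" "i \<noteq> j"
    and eq: "lattice_edge (path_vertex w i) (w ! i) = lattice_edge (path_vertex w j) (w ! j)"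
  then have i: "i < length w" and j: "j < length w" by auto
  have "path_vertex w i \<noteq> path_vertex w j" using inj_onD[OF inj, of i j] i j \<open>i \<noteq> j\<close> by auto
  then have vj: "path_vertex w j = path_vertex w (Suc i)" and op: "w ! j = opposite (w ! i)"
    using eq i by (auto simp: lattice_edge_eq_iff path_vertex_Suc)
  have vi: "path_vertex w i = path_vertex w (Suc j)"
    using j by (simp add: path_vertex_Suc op vj step_opposite) (simp add: path_vertex_Suc i)
  have no_turn: "w ! Suc n \<noteq> opposite (w ! n)" if "Suc n < length w" for n
    using cell_left_around_vertex(1)[OF boundary_word_edges_at_vertex[OF bw that]] .
  have "j \<noteq> Suc i" using no_turn[of i] op j by auto
  \<comment> \<open>What remains is \<open>j = 0\<close> and \<open>i = 1\<close>, a word of length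
    two, which again reverses.\<close>
  have "Suc i = length w"
  proof (rule ccontr)
    assume "Suc i \<noteq> length w"
    then have "j = Suc i" using i j by (intro inj_onD[OF inj vj]) auto
    with \<open>j \<noteq> Suc i\<close> show False ..
  qed
  then have "path_vertex w j = path_vertex w 0" using vj closed by simp
  then have "j = 0" by (rule inj_onD[OF inj]) (use j in auto)
  then have "i = Suc 0" using inj_onD[OF inj vi] i \<open>i \<noteq> j\<close> by auto
  then show False using no_turn[of j] i op \<open>j = 0\<close> by auto
qed

text \<open>The integral of \<open>x dy\<close> along an edge that is traversed with \<open>C\<close> on its left.\<close>

fun edge_weight :: "(int \<times> int) set \<Rightarrow> edge \<Rightarrow> int" where
  "edge_weight C (Horiz c) = 0"
| "edge_weight C (Vert (x, y)) = x * (of_bool ((x - 1, y) \<in> C) - of_bool ((x, y) \<in> C))"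

text \<open>Discrete Green identity: a cell contributes \<open>x + 1\<close> on its right side and
  \<open>- x\<close> on its left side, and sides shared by two cells of \<open>C\<close>
  cancel.\<close>

lemma sum_edge_weight_boundary_edges:
  assumes "finite C"
  shows "(\<Sum>e\<in>boundary_edges C. edge_weight C e) = int (card C)"
proof -
  \<comment> \<open>\<open>C'\<close> indexes the right sides of the cells of \<open>C\<close>, and
    \<open>C\<close> itself their left sides.\<close>
  define C' where "C' = (\<lambda>(x, y). (x + 1, y)) ` C"
  have C': "(x, y) \<in> C' \<longleftrightarrow> (x - 1, y) \<in> C" for x y by (force simp: C'_def)
  have fin: "finite C'" using assms by (simp add: C'_def)
  have "(\<Sum>e\<in>boundary_edges C. edge_weight C e) = (\<Sum>e\<in>Vert ` (C \<union> C'). edge_weight C e)"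
  proof (rule sum.mono_neutral_cong)
    fix e assume "e \<in> Vert ` (C \<union> C') - boundary_edges C"
    then show "edge_weight C e = 0" by (auto simp: boundary_edges_def C')
  next
    fix e assume "e \<in> boundary_edges C - Vert ` (C \<union> C')"
    then show "edge_weight C e = 0"
      by (cases e rule: edge_mid.cases) (auto simp: boundary_edges_def C' image_iff)
  qed (use assms fin in \<open>auto intro: finite_boundary_edges\<close>)
  also have "\<dots> = (\<Sum>c\<in>C \<union> C'. fst c * of_bool (c \<in> C') - fst c * of_bool (c \<in> C))"
    by (subst sum.reindex) (auto simp: inj_on_def  C' algebra_simps intro!: sum.cong)
  also have "\<dots> = (\<Sum>c\<in>C'. fst c) - (\<Sum>c\<in>C. fst c)"
    unfolding sum_subtractf
    by (intro arg_cong2[where f = minus] sum.mono_neutral_cong_right) (use assms fin in auto)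
  also have "(\<Sum>c\<in>C'. fst c) = (\<Sum>c\<in>C. fst c + 1)"
    unfolding C'_def by (subst sum.reindex) (auto simp: inj_on_def intro!: sum.cong)
  finally show ?thesis by (simp add: sum.distrib)
qed

lemma abs_signed_area_boundary_word:
  assumes "finite C" and bw: "boundary_word (\<Union>c\<in>C. unit_square c) w"
  shows "\<bar>signed_area w\<bar> = int (card C)"
proof -
  \<comment> \<open>The first step decides on which side of the whole path \<open>C\<close> lies,
    hence the sign.\<close>
  define \<epsilon> :: int where "\<epsilon> = (if cell_left (0, 0) (w ! 0) \<in> C then 1 else - 1)"
  let ?e = "\<lambda>i. lattice_edge (path_vertex w i) (w ! i)"
  have "fst (path_vertex w i) * snd (step (w ! i)) = \<epsilon> * edge_weight C (?e i)" if "i < length w" for i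
  proof -
    obtain x y where v: "path_vertex w i = (x, y)" by (cases "path_vertex w i")
    have "?e i \<in> boundary_edges C" using boundary_word_edges[OF bw] that by blast
    then show ?thesis
      using boundary_word_cell_left[OF bw that]
      by (cases "w ! i") (auto simp: v  \<epsilon>_def boundary_edges_def)
  qed
  then have "signed_area w = \<epsilon> * (\<Sum>i<length w. edge_weight C (?e i))"
    by (simp add: signed_area_def sum_distrib_left)
  also have "(\<Sum>i<length w. edge_weight C (?e i)) = (\<Sum>e\<in>boundary_edges C. edge_weight C e)"
  proof (rule sum.reindex_bij_betw)
    show "bij_betw ?e {..<length w} (boundary_edges C)"
      unfolding bij_betw_def using boundary_word_inj_edges[OF bw] boundary_word_edges[OF bw] by auto
  qed
  also have "\<dots> = int (card C)"
    using assms(1) by (rule sum_edge_weight_boundary_edges)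
  finally show ?thesis by (simp add: \<epsilon>_def abs_mult)
qed

text \<open>Distinct steps give distinct unit edges inside the frontier.\<close>

lemma length_boundary_word_le_perimeter:
  assumes "finite C" and bw: "boundary_word (\<Union>c\<in>C. unit_square c) w"
  shows "length w \<le> perimeter (\<Union>c\<in>C. unit_square c)"
proof -
  have "inj_on (\<lambda>i. unit_edge (path_vertex w i) (w ! i)) {..<length w}"
    using boundary_word_inj_edges[OF bw] edge_mid_in_edge_set_iff
    unfolding inj_on_def unit_edge_eq by metis
  moreover have "unit_edge (path_vertex w i) (w ! i) \<subseteq> frontier (\<Union>c\<in>C. unit_square c)"
    if "i < length w" for i
    using bw that unfolding boundary_word_def by blast
  ultimately have "card {..<length w} \<le> perimeter (\<Union>c\<in>C. unit_square c)"
    unfolding perimeter_def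
    by (intro card_inj_on_le finite_unit_edges_in_frontier assms(1)) blast+
  then show ?thesis by simp
qed

theorem lemma1p5:
  fixes P :: "(real \<times> real) set" and w :: "letter list"
  assumes "minimal_perimeter_polyomino P"
    and "(0, 0) \<in> frontier P"
    and "boundary_word P w"
  shows "dead_end_word w"
proof -
  obtain C where "finite C" and P: "P = (\<Union>c\<in>C. unit_square c)"
    using assms(1) by (auto simp: minimal_perimeter_polyomino_def polyomino_def)
  obtain k :: nat where k: "k \<ge> 1" "area P = real k"
    and minimal: "\<And>Q. polyomino Q \<Longrightarrow> area Q = real k \<Longrightarrow> perimeter P \<le> perimeter Q"
    using assms(1) by (auto simp: minimal_perimeter_polyomino_def)
  have "card C = k" using k(2) area_Union_unit_squares[OF \<open>finite C\<close>] by (simp add: P)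
  then have area: "\<bar>signed_area w\<bar> = int k"
    using abs_signed_area_boundary_word[OF \<open>finite C\<close>] assms(3) by (simp add: P)
  have closed: "path_vertex w (length w) = (0, 0)"
    using assms(3) by (simp add: boundary_word_def)
  have "geodesic_word w"
  proof (rule geodesic_wordI)
    fix v assume "word_elem v = word_elem w"
    then have closed_v: "path_vertex v (length v) = (0, 0)" and area_v: "signed_area v = signed_area w"
      using closed by (auto simp: word_elem_eq heis_matrix_eq_iff prod_eq_iff)
    \<comment> \<open>The sides of the rectangle are the numbers of letters \<open>A\<close> and
      \<open>B\<close> in the competing word \<open>v\<close>.\<close>
    then have "k \<le> count_list v A * count_list v B"
      using abs_signed_area_le[OF closed_v] unfolding area_v area of_nat_le_iff by blast
    then obtain Q where Q: "polyomino Q" "area Q = real k"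
      "perimeter Q \<le> 2 * (count_list v A + count_list v B)"
      using polyomino_in_rectangle[OF k(1)] by blast
    have "length w \<le> perimeter P"
      using length_boundary_word_le_perimeter[OF \<open>finite C\<close>] assms(3) by (simp add: P)
    also have "\<dots> \<le> perimeter Q" using Q(1,2) by (rule minimal)
    also have "\<dots> \<le> length v" using Q(3) closed_path_counts(3)[OF closed_v] by simp
    finally show "length w \<le> length v" .
  qed
  moreover have "signed_area w \<noteq> 0" using area k(1) by auto
  ultimately show ?thesis
    using closed_word_not_geodesic_snoc[OF closed] by (simp add: dead_end_word_def)
qed

end
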